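(* Let $f(z)=z+\sum_{n=2}^{\infty}a_nz^n$ belong to the class $\mathcal{SL}^*$. Then the second Hankel determinant $H_2(3)=a_3a_5-a_4^2$ satisfies $$|H_2(3)|\le\frac{1}{36}.$$ The result is sharp, i.e. there exists a function $f\in\mathcal{SL}^*$ for which $|H_2(3)|=\frac1{36}$.
   Context: $\Delta=\{z\in\mathbb{C}:|z|<1\}$ is the open unit disk. $\mathcal{A}$ is the class of analytic functions on $\Delta$ of the form $f(z)=z+\sum_{n=2}^{\infty}a_nz^n$. For analytic functions $F,G$ on $\Delta$, $F$ is subordinate to $G$, written $F\prec G$, if there is an analytic function $\omega:\Delta\to\mathbb{C}$ with $\omega(0)=0$ and $|\omega(z)|<1$ for $z\in\Delta$ such that $F(z)=G(\omega(z))$ for all $z\in\Delta$. The class $\mathcal{SL}^*$ is $$\mathcal{SL}^*=\left\{f\in\mathcal{A}:\ \frac{zf'(z)}{f(z)}\prec\sqrt{1+z},\ z\in\Delta\right\},$$ where $\sqrt{\cdot}$ is the principal branch (value $1$ at $z=0$), and $zf'(z)/f(z)$ is understood to take the value $1$ at $z=0$. *)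

theory Defs
  imports "HOL-Complex_Analysis.Complex_Analysis"
begin

abbreviation unit_disk :: "complex set" ("\<Delta>")
  where "\<Delta> \<equiv> ball 0 1"

definition taylor_coeff :: "(complex \<Rightarrow> complex) \<Rightarrow> nat \<Rightarrow> complex"
  where "taylor_coeff f n = fps_nth (fps_expansion f 0) n"

definition class_A :: "(complex \<Rightarrow> complex) set"
  where "class_A = {f. f holomorphic_on \<Delta> \<and>
    (\<forall>z\<in>\<Delta>. (\<lambda>n. taylor_coeff f (n + 2) * z ^ (n + 2)) sums (f z - z))}"

definition subordinate :: "(complex \<Rightarrow> complex) \<Rightarrow> (complex \<Rightarrow> complex) \<Rightarrow> bool"  (infix "\<prec>" 50)
  where "F \<prec> G \<longleftrightarrow> F holomorphic_on \<Delta> \<and> G holomorphic_on \<Delta> \<and>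
    (\<exists>\<omega>. \<omega> holomorphic_on \<Delta> \<and> \<omega> 0 = 0 \<and> (\<forall>z\<in>\<Delta>. norm (\<omega> z) < 1) \<and>
         (\<forall>z\<in>\<Delta>. F z = G (\<omega> z)))"

text \<open>The removable singularity of \<open>z f'(z) / f(z)\<close> at \<open>0\<close> is filled with \<open>1\<close>.  Where \<open>f\<close> has a
  zero \<open>z \<noteq> 0\<close> in the disk, the quotient has a pole in the usual reading but value \<open>0\<close> in HOL; since
  \<open>csqrt (1 + w) \<noteq> 0\<close> for \<open>w \<in> \<Delta>\<close>, such an \<open>f\<close> is excluded from \<open>class_SL\<close> under both readings.\<close>

definition star_quotient :: "(complex \<Rightarrow> complex) \<Rightarrow> complex \<Rightarrow> complex"
  where "star_quotient f z = (if z = 0 then 1 else z * deriv f z / f z)"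

definition class_SL :: "(complex \<Rightarrow> complex) set"
  where "class_SL = {f \<in> class_A. star_quotient f \<prec> (\<lambda>z. csqrt (1 + z))}"

definition hankel2 :: "(complex \<Rightarrow> complex) \<Rightarrow> nat \<Rightarrow> complex"
  where "hankel2 f n = taylor_coeff f n * taylor_coeff f (n + 2) - (taylor_coeff f (n + 1))\<^sup>2"

end

theory Submission
  imports Defs
begin

text \<open>
  Write \<open>z f' = p f\<close> with \<open>p\<^sup>2 = 1 + \<omega>\<close>.  Comparing coefficients expresses \<open>a\<^sub>3 a\<^sub>5 - a\<^sub>4\<^sup>2\<close> through the
  first four Taylor coefficients \<open>w\<^sub>1, \<dots>, w\<^sub>4\<close> of the Schwarz function \<open>\<omega>\<close>, with dominant term
  \<open>- w\<^sub>3\<^sup>2 / 36\<close>.  No finer information on Schwarz functions is needed than the Bessel inequality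
  \<open>\<bar>w\<^sub>1\<bar>\<^sup>2 + \<bar>w\<^sub>2\<bar>\<^sup>2 + \<bar>w\<^sub>3\<bar>\<^sup>2 + \<bar>w\<^sub>4\<bar>\<^sup>2 \<le> 1\<close>: after the triangle inequality, the terms other than \<open>w\<^sub>3\<^sup>2\<close>
  are dominated by \<open>\<bar>w\<^sub>1\<bar>\<^sup>2 + \<bar>w\<^sub>2\<bar>\<^sup>2 + \<bar>w\<^sub>4\<bar>\<^sup>2\<close>.  Equality occurs for \<open>\<omega> z = z\<^sup>3\<close>.
\<close>

section \<open>Taylor coefficients as circle integrals, and Bessel's inequality\<close>

lemma taylor_coeff_eqI:
  assumes "f has_fps_expansion F"
  shows "taylor_coeff f n = fps_nth F n"
  by (simp add: taylor_coeff_def fps_expansion_eqI[OF assms])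

lemma taylor_coeff_polynomial:
  "taylor_coeff (\<lambda>z. \<Sum>k\<le>n. a k * z ^ k) k = (if k \<le> n then a k else 0)"
proof -
  have "(\<lambda>z. \<Sum>k\<le>n. a k * z ^ k) has_fps_expansion (\<Sum>k\<le>n. fps_const (a k) * fps_X ^ k)"
    by (intro fps_expansion_intros)
  from taylor_coeff_eqI[OF this] show ?thesis
    by (simp add: fps_sum_nth if_distrib cong: if_cong)
qed

lemma taylor_coeff_has_integral:
  assumes "g holomorphic_on \<Delta>" "0 < r" "r < 1"
  shows "((\<lambda>t. g (of_real r * cis t) * cis (- (real k * t))) has_integral
           2 * of_real pi * of_real r ^ k * taylor_coeff g k) {0..2 * pi}"
proof -
  have sub: "cball 0 r \<subseteq> \<Delta>"
    using assms by auto
  have "((\<lambda>u. g u / (u - 0) ^ Suc k) has_contour_integral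
      2 * pi * \<i> / fact k * (deriv ^^ k) g 0) (circlepath 0 r)"
    using assms holomorphic_on_subset[OF assms(1) sub]
    by (intro Cauchy_has_contour_integral_higher_derivative_circlepath holomorphic_on_imp_continuous_on)
       (auto intro: holomorphic_on_subset)
  hence "((\<lambda>t. g (0 + of_real r * cis t) / (0 + of_real r * cis t - 0) ^ Suc k * of_real r * \<i> * cis t)
      has_integral 2 * pi * \<i> / fact k * (deriv ^^ k) g 0) {0..2 * pi}"
    unfolding circlepath_def by (subst (asm) has_contour_integral_part_circlepath_iff) auto
  \<comment> \<open>On the circle \<open>u = r cis t\<close>, the factor
    \<open>du / u ^ Suc k\<close> is \<open>\<i> / u ^ k\<close> times \<open>dt\<close>;
    multiplying by \<open>r ^ k / \<i>\<close> leaves the Fourier kernel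
    \<open>cis (- k t)\<close>.\<close>
  from has_integral_mult_right[OF this, of "of_real r ^ k / \<i>"]
  show ?thesis
  proof (rule has_integral_eq_rhs[OF has_integral_eq, rotated])
    fix t :: real
    have "cis (- (real k * t)) = inverse (cis t ^ k)"
      by (simp add: Complex.DeMoivre cis_inverse)
    thus "of_real r ^ k / \<i> *
        (g (0 + of_real r * cis t) / (0 + of_real r * cis t - 0) ^ Suc k * of_real r * \<i> * cis t) =
        g (of_real r * cis t) * cis (- (real k * t))"
      using assms by (simp add: field_simps power_mult_distrib)
  qed (simp_all add: taylor_coeff_def fps_expansion_def field_simps)
qed

text \<open>Conjugating the polynomial turns it into a finite sum of kernels
  \<open>cis (- k t)\<close>, each of which picks out one coefficient of \<open>g\<close>. Pairing
  with a polynomial avoids integrating an infinite series.\<close>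

lemma mult_cnj_polynomial_has_integral:
  assumes "g holomorphic_on \<Delta>" "0 < r" "r < 1"
  shows "((\<lambda>t. g (of_real r * cis t) * cnj (\<Sum>k\<le>n. a k * (of_real r * cis t) ^ k)) has_integral
           2 * of_real pi * (\<Sum>k\<le>n. of_real r ^ (2 * k) * taylor_coeff g k * cnj (a k))) {0..2 * pi}"
proof -
  have "((\<lambda>t. \<Sum>k\<le>n. cnj (a k) * of_real r ^ k *
           (g (of_real r * cis t) * cis (- (real k * t)))) has_integral
         (\<Sum>k\<le>n. cnj (a k) * of_real r ^ k *
           (2 * of_real pi * of_real r ^ k * taylor_coeff g k))) {0..2 * pi}"
    by (intro has_integral_sum has_integral_mult_right taylor_coeff_has_integral assms) auto
  thus ?thesis
  proof (rule has_integral_eq_rhs[OF has_integral_eq, rotated])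
    fix t :: real
    show "(\<Sum>k\<le>n. cnj (a k) * of_real r ^ k * (g (of_real r * cis t) * cis (- (real k * t)))) =
        g (of_real r * cis t) * cnj (\<Sum>k\<le>n. a k * (of_real r * cis t) ^ k)"
      by (simp add: sum_distrib_left power_mult_distrib Complex.DeMoivre cis_cnj mult_ac)
  qed (simp add: sum_distrib_left power_mult power2_eq_square power_mult_distrib mult_ac)
qed

text \<open>On the circle of radius \<open>r < 1\<close>, integrate
  \<open>0 \<le> 1 - 2 Re (g cnj P) + |P|^2\<close>, where \<open>P\<close> is the Taylor polynomial
  of degree \<open>n\<close>. Both \<open>g cnj P\<close> and \<open>|P|^2\<close> integrate to
  \<open>2 * pi * S r\<close>, so \<open>S r \<le> 1\<close>; then let \<open>r\<close> tend to
  1.\<close>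

theorem taylor_coeff_bessel:
  assumes holo: "g holomorphic_on \<Delta>" and bound: "\<And>z. z \<in> \<Delta> \<Longrightarrow> norm (g z) \<le> 1"
  shows "(\<Sum>k\<le>n. (norm (taylor_coeff g k))\<^sup>2) \<le> 1"
proof -
  define P where "P = (\<lambda>z. \<Sum>k\<le>n. taylor_coeff g k * z ^ k)"
  define S where "S = (\<lambda>r. \<Sum>k\<le>n. r ^ (2 * k) * (norm (taylor_coeff g k))\<^sup>2)"
  have "S r \<le> 1" if r: "0 < r" "r < 1" for r
  proof -
    \<comment> \<open>Stated for any \<open>h\<close> sharing the coefficients of \<open>g\<close>
      up to \<open>n\<close>, so that it serves both \<open>h = g\<close> and
      \<open>h = P\<close>.\<close>
    have int: "((\<lambda>t. Re (h (of_real r * cis t) * cnj (P (of_real r * cis t)))) has_integral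
        2 * pi * S r) {0..2 * pi}"
      if "h holomorphic_on \<Delta>" "\<And>k. k \<le> n \<Longrightarrow> taylor_coeff h k = taylor_coeff g k" for h
    proof -
      have "(\<Sum>k\<le>n. of_real r ^ (2 * k) * taylor_coeff h k * cnj (taylor_coeff g k)) = complex_of_real (S r)"
        by (simp add: S_def that mult.assoc complex_norm_square[symmetric])
      with mult_cnj_polynomial_has_integral[OF that(1) r, of "taylor_coeff g" n]
      have "((\<lambda>t. h (of_real r * cis t) * cnj (P (of_real r * cis t))) has_integral
          complex_of_real (2 * pi * S r)) {0..2 * pi}"
        by (simp add: P_def)
      from has_integral_Re[OF this] show ?thesis by simp
    qed
    have "P holomorphic_on \<Delta>"
      unfolding P_def by (intro holomorphic_intros)
    have "((\<lambda>t. 1 - 2 * Re (g (of_real r * cis t) * cnj (P (of_real r * cis t)))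
         + Re (P (of_real r * cis t) * cnj (P (of_real r * cis t)))) has_integral
         (2 * pi - 2 * (2 * pi * S r) + 2 * pi * S r)) {0..2 * pi}"
      using has_integral_const_real[of "1::real" 0 "2 * pi"] \<open>P holomorphic_on \<Delta>\<close>
      by (intro has_integral_add has_integral_diff has_integral_mult_right int holo)
         (auto simp: P_def taylor_coeff_polynomial)
    hence "0 \<le> 2 * pi - 2 * (2 * pi * S r) + 2 * pi * S r"
    proof (rule has_integral_nonneg)
      fix t :: real
      define u v where "u = g (of_real r * cis t)" and "v = P (of_real r * cis t)"
      have "norm u \<le> 1"
        unfolding u_def using r by (intro bound) (auto simp: norm_mult)
      hence "(Re u)\<^sup>2 + (Im u)\<^sup>2 \<le> 1"
        by (simp add: power_le_one flip: cmod_power2)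
      \<comment> \<open>The integrand is \<open>(1 - |u|^2) + |u - v|^2\<close>, a sum of two
        nonnegative terms.\<close>
      moreover have "1 - 2 * Re (u * cnj v) + Re (v * cnj v) =
          (1 - ((Re u)\<^sup>2 + (Im u)\<^sup>2)) + (Re u - Re v)\<^sup>2 + (Im u - Im v)\<^sup>2"
        by (simp add: power2_eq_square algebra_simps)
      ultimately have "0 \<le> 1 - 2 * Re (u * cnj v) + Re (v * cnj v)"
        by (simp only:) simp
      thus "0 \<le> 1 - 2 * Re (g (of_real r * cis t) * cnj (P (of_real r * cis t)))
         + Re (P (of_real r * cis t) * cnj (P (of_real r * cis t)))"
        by (simp add: u_def v_def)
    qed
    hence "2 * pi * S r \<le> 2 * pi * 1" by simp
    thus ?thesis
      by (subst (asm) mult_le_cancel_left_pos) auto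
  qed
  moreover have "(S \<longlongrightarrow> S 1) (at_left 1)"
    unfolding S_def by (intro tendsto_intros)
  ultimately have "S 1 \<le> 1"
    by (intro tendsto_upperbound[of S "S 1" "at_left 1"])
       (auto simp: eventually_at_left_field intro!: exI[of _ 0])
  thus ?thesis by (simp add: S_def)
qed

section \<open>Normalisation and the square root on the disk\<close>

text \<open>A holomorphic \<open>f\<close> is already the sum of its Taylor series on the disk, so
  the series condition in \<open>class_A\<close> only says that \<open>a0 + a1 z = z\<close>
  there.\<close>

lemma class_A_iff:
  "f \<in> class_A \<longleftrightarrow> f holomorphic_on \<Delta> \<and> taylor_coeff f 0 = 0 \<and> taylor_coeff f 1 = 1"
proof (cases "f holomorphic_on \<Delta>")
  case True
  have sums: "(\<lambda>n. taylor_coeff f (n + 2) * z ^ (n + 2)) sums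
      (f z - (taylor_coeff f 0 + taylor_coeff f 1 * z))" if "z \<in> \<Delta>" for z
  proof -
    have "(\<lambda>n. taylor_coeff f n * z ^ n) sums f z"
      using holomorphic_power_series[OF True that] by (simp add: taylor_coeff_def fps_expansion_def)
    from sums_split_initial_segment[OF this, of 2] show ?thesis
      by (simp add: numeral_2_eq_2)
  qed
  have "taylor_coeff f 0 = 0 \<and> taylor_coeff f 1 = 1" if "f \<in> class_A"
  proof -
    have eq: "taylor_coeff f 0 + taylor_coeff f 1 * z = z" if "z \<in> \<Delta>" for z
    proof -
      have "(\<lambda>n. taylor_coeff f (n + 2) * z ^ (n + 2)) sums (f z - z)"
        using \<open>f \<in> class_A\<close> that unfolding class_A_def by blast
      from sums_unique2[OF sums[OF that] this] show ?thesis by (simp add: algebra_simps)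
    qed
    from eq[of 0] have "taylor_coeff f 0 = 0" by simp
    moreover from this eq[of "1 / 2"] have "taylor_coeff f 1 = 1" by simp
    ultimately show ?thesis by simp
  qed
  with True sums show ?thesis
    by (auto simp: class_A_def)
qed (simp add: class_A_def)

lemma taylor_coeff_zero_one:
  "taylor_coeff f 0 = f 0" "taylor_coeff f 1 = deriv f 0"
  by (simp_all add: taylor_coeff_def fps_expansion_def)

lemma csqrt_one_plus_holomorphic: "(\<lambda>z. csqrt (1 + z)) holomorphic_on \<Delta>"
proof (intro holomorphic_intros)
  fix z :: complex
  assume "z \<in> \<Delta>"
  hence "\<bar>Re z\<bar> < 1"
    using abs_Re_le_cmod[of z] by simp
  thus "1 + z \<notin> \<real>\<^sub>\<le>\<^sub>0"
    by (auto simp: complex_nonpos_Reals_iff)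
qed

section \<open>The Hankel determinant in terms of Schwarz coefficients\<close>

text \<open>Using \<open>p^2 = 1 + \<omega>\<close> instead of \<open>csqrt\<close> avoids the
  binomial series: both equations become recursions between formal power series. The same identity
  serves the upper bound and the extremal function.\<close>

lemma hankel2_3_schwarz_coeffs:
  assumes f: "f \<in> class_A" and \<omega>: "\<omega> holomorphic_on \<Delta>"
    and p: "p holomorphic_on \<Delta>" "p 0 = 1" "\<And>z. z \<in> \<Delta> \<Longrightarrow> (p z)\<^sup>2 = 1 + \<omega> z"
    and deriv: "\<And>z. z \<in> \<Delta> \<Longrightarrow> z * deriv f z = p z * f z"
  defines "w \<equiv> taylor_coeff \<omega>"
  shows "36 * hankel2 f 3 =
    36 * (w 2 / 4 + (w 1)\<^sup>2 / 16) *
      (w 4 / 8 + w 1 * w 3 / 48 + (w 1)\<^sup>2 * w 2 / 48 - w 1 ^ 4 / 384)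
    - (w 3 + w 1 * w 2 / 4 + w 1 ^ 3 / 16)\<^sup>2"
proof -
  define F P W where "F = fps_expansion f 0" and "P = fps_expansion p 0" and "W = fps_expansion \<omega> 0"
  have exp: "f has_fps_expansion F" "p has_fps_expansion P" "\<omega> has_fps_expansion W"
    unfolding F_def P_def W_def using f \<omega> p
    by (auto simp: class_A_def intro!: has_fps_expansion_fps_expansion[of "\<Delta>"])
  have ev: "\<forall>\<^sub>F z in nhds 0. z \<in> \<Delta>"
    by (intro eventually_nhds_in_open) auto
  have 1: "P * P = 1 + W"
  proof (rule fps_expansion_unique_complex)
    show "(\<lambda>z. 1 + \<omega> z) has_fps_expansion 1 + W"
      by (intro fps_expansion_intros exp)
    have "\<forall>\<^sub>F z in nhds 0. p z * p z = 1 + \<omega> z"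
      using ev by eventually_elim (use p(3) in \<open>simp add: power2_eq_square\<close>)
    moreover have "(\<lambda>z. p z * p z) has_fps_expansion P * P"
      by (intro fps_expansion_intros exp)
    ultimately show "(\<lambda>z. 1 + \<omega> z) has_fps_expansion P * P"
      by (subst (asm) has_fps_expansion_cong) auto
  qed
  have 2: "fps_X * fps_deriv F = P * F"
  proof (rule fps_expansion_unique_complex)
    show "(\<lambda>z. p z * f z) has_fps_expansion P * F"
      by (intro fps_expansion_intros exp)
    have "\<forall>\<^sub>F z in nhds 0. z * deriv f z = p z * f z"
      using ev by eventually_elim (use deriv in simp)
    moreover have "(\<lambda>z. z * deriv f z) has_fps_expansion fps_X * fps_deriv F"
      by (intro fps_expansion_intros exp)
    ultimately show "(\<lambda>z. p z * f z) has_fps_expansion fps_X * fps_deriv F"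
      by (subst (asm) has_fps_expansion_cong) auto
  qed
  define a where "a = fps_nth F"
  define q where "q = fps_nth P"
  have w: "w = fps_nth W" and a': "taylor_coeff f = a"
    by (auto simp: w_def a_def F_def W_def taylor_coeff_def)
  have a01: "a 0 = 0" "a 1 = 1"
    using f by (simp_all add: class_A_iff a')
  \<comment> \<open>This selects the branch of the root: the recursion for \<open>P * P\<close> then
    contains \<open>q n\<close> as \<open>2 * q n\<close> and can be solved for it.\<close>
  have q0: "q 0 = 1"
    using p(2) by (simp add: q_def P_def fps_expansion_def)
  have q: "(\<Sum>i=0..n. q i * q (n - i)) = w n" if "n > 0" for n
    using arg_cong[OF 1, of "\<lambda>X. fps_nth X n"] that by (simp add: fps_mult_nth q_def w)
  \<comment> \<open>The term \<open>i = 0\<close> is \<open>a n\<close> itself, leaving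
    \<open>(n - 1) * a n\<close> on the left; hence the divisors 2, 3, 4 for \<open>a 3\<close>,
    \<open>a 4\<close>, \<open>a 5\<close> below.\<close>
  have fa: "of_nat n * a n = (\<Sum>i=0..n. q i * a (n - i))" if "n > 0" for n
  proof -
    have "fps_nth (fps_X * fps_deriv F) n = of_nat n * a n"
      using that by (simp add: a_def)
    thus ?thesis
      by (simp add: 2 fps_mult_nth q_def a_def)
  qed
  note expand = numeral_eq_Suc sum.atLeast0_atMost_Suc
  have q1: "q 1 = w 1 / 2"
    using q[of 1] q0 by (simp add: field_simps)
  have q2: "q 2 = w 2 / 2 - (w 1)\<^sup>2 / 8"
  proof -
    have "q 2 = (w 2 - q 1 * q 1) / 2"
      using q[of 2] q0 by (simp add: expand field_simps)
    also have "\<dots> = w 2 / 2 - (w 1)\<^sup>2 / 8"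
      unfolding q1 by (simp add: eval_nat_numeral field_simps)
    finally show ?thesis .
  qed
  have q3: "q 3 = w 3 / 2 - w 1 * w 2 / 4 + w 1 ^ 3 / 16"
  proof -
    have "q 3 = (w 3 - 2 * q 1 * q 2) / 2"
      using q[of 3] q0 by (simp add: expand field_simps)
    also have "\<dots> = w 3 / 2 - w 1 * w 2 / 4 + w 1 ^ 3 / 16"
      unfolding q1 q2 by (simp add: eval_nat_numeral field_simps)
    finally show ?thesis .
  qed
  have q4: "q 4 = w 4 / 2 - (2 * w 1 * w 3 + (w 2)\<^sup>2) / 8 + 3 * (w 1)\<^sup>2 * w 2 / 16 - 5 * w 1 ^ 4 / 128"
  proof -
    have "q 4 = (w 4 - 2 * q 1 * q 3 - q 2 * q 2) / 2"
      using q[of 4] q0 by (simp add: expand field_simps)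
    also have "\<dots> = w 4 / 2 - (2 * w 1 * w 3 + (w 2)\<^sup>2) / 8 + 3 * (w 1)\<^sup>2 * w 2 / 16 - 5 * w 1 ^ 4 / 128"
      unfolding q1 q2 q3 by (simp add: eval_nat_numeral field_simps)
    finally show ?thesis .
  qed
  have a2: "a 2 = w 1 / 2"
  proof -
    have "a 2 = q 1"
      using fa[of 2] a01 q0 by (simp add: expand field_simps)
    also have "\<dots> = w 1 / 2"
      unfolding q1 by (simp add: eval_nat_numeral field_simps)
    finally show ?thesis .
  qed
  have a3: "a 3 = w 2 / 4 + (w 1)\<^sup>2 / 16"
  proof -
    have "a 3 = (q 1 * a 2 + q 2) / 2"
      using fa[of 3] a01 q0 by (simp add: expand field_simps)
    also have "\<dots> = w 2 / 4 + (w 1)\<^sup>2 / 16"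
      unfolding q1 q2 a2 by (simp add: eval_nat_numeral field_simps)
    finally show ?thesis .
  qed
  have a4: "a 4 = (w 3 + w 1 * w 2 / 4 + w 1 ^ 3 / 16) / 6"
  proof -
    have "a 4 = (q 1 * a 3 + q 2 * a 2 + q 3) / 3"
      using fa[of 4] a01 q0 by (simp add: expand field_simps)
    also have "\<dots> = (w 3 + w 1 * w 2 / 4 + w 1 ^ 3 / 16) / 6"
      unfolding q1 q2 q3 a2 a3 by (simp add: eval_nat_numeral field_simps)
    finally show ?thesis .
  qed
  have a5: "a 5 = w 4 / 8 + w 1 * w 3 / 48 + (w 1)\<^sup>2 * w 2 / 48 - w 1 ^ 4 / 384"
  proof -
    have "a 5 = (q 1 * a 4 + q 2 * a 3 + q 3 * a 2 + q 4) / 4"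
      using fa[of 5] a01 q0 by (simp add: expand field_simps)
    also have "\<dots> = w 4 / 8 + w 1 * w 3 / 48 + (w 1)\<^sup>2 * w 2 / 48 - w 1 ^ 4 / 384"
      unfolding q1 q2 q3 q4 a2 a3 a4 by (simp add: eval_nat_numeral field_simps)
    finally show ?thesis .
  qed
  show ?thesis
    by (simp add: hankel2_def a' a3 a4 a5 power_divide algebra_simps)
qed

section \<open>The upper bound\<close>

text \<open>Here \<open>c\<close>, \<open>x\<close>, \<open>y\<close>, \<open>v\<close> stand for
  the moduli of \<open>w 1\<close>, ..., \<open>w 4\<close>. As all but \<open>v\<close> are bounded
  by 1 through \<open>sq\<close>, every monomial of degree above two can be lowered to a quadratic
  one free of \<open>y\<close>; what remains besides \<open>y^2\<close> is a quadratic form in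
  \<open>c\<close>, \<open>x\<close>, \<open>v\<close>.\<close>

lemma hankel_majorant_le_one:
  fixes c x y v :: real
  assumes nonneg: "0 \<le> c" "0 \<le> x" "0 \<le> y" "0 \<le> v"
    and le: "c\<^sup>2 + x\<^sup>2 + y\<^sup>2 + v\<^sup>2 \<le> 1"
  shows "36 * (x / 4 + c\<^sup>2 / 16) * (v / 8 + c * y / 48 + c\<^sup>2 * x / 48 + c ^ 4 / 384)
      + (y + c * x / 4 + c ^ 3 / 16)\<^sup>2 \<le> 1"
proof -
  have sq: "c\<^sup>2 \<le> 1" "x\<^sup>2 \<le> 1" "y\<^sup>2 \<le> 1"
    using le zero_le_power2[of c] zero_le_power2[of x] zero_le_power2[of y] zero_le_power2[of v] by linarith+
  hence c: "c \<le> 1" and x: "x \<le> 1" and y: "y \<le> 1"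
    by (auto simp: power2_le_iff_abs_le abs_le_square_iff[symmetric] abs_square_le_1)
  have 1: "c * x * y \<le> c * x"
    using nonneg y by (simp add: mult_left_le)
  have "c * y \<le> 1"
    using nonneg c y by (simp add: mult_le_one)
  hence 2: "c ^ 3 * y \<le> c\<^sup>2"
    using mult_left_le[of "c * y" "c\<^sup>2"] by (simp add: power2_eq_square power3_eq_cube mult_ac)
  have "c * x \<le> 1"
    using nonneg c x by (simp add: mult_le_one)
  hence 3: "c\<^sup>2 * x\<^sup>2 \<le> c * x"
    using mult_left_le[of "c * x" "c * x"] nonneg by (simp add: power2_eq_square mult_ac)
  have "c ^ 3 \<le> 1"
    using nonneg c by (simp add: power_le_one)
  hence 4: "c ^ 4 * x \<le> c * x"
    using mult_left_le[of "c ^ 3" "c * x"] nonneg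
    by (simp add: eval_nat_numeral mult_ac)
  have 5: "c\<^sup>2 * v \<le> c * v"
    using mult_left_le[of c "c * v"] nonneg c by (simp add: power2_eq_square mult_ac)
  have "c ^ 4 \<le> 1"
    using nonneg c by (simp add: power_le_one)
  hence 6: "c ^ 6 \<le> c\<^sup>2"
    using mult_left_le[of "c ^ 4" "c\<^sup>2"] by (simp flip: power_add)
  have "36 * (x / 4 + c\<^sup>2 / 16) * (v / 8 + c * y / 48 + c\<^sup>2 * x / 48 + c ^ 4 / 384)
      + (y + c * x / 4 + c ^ 3 / 16)\<^sup>2
    = y\<^sup>2 + 9/8 * (x * v) + 11/16 * (c * x * y) + 11/64 * (c ^ 3 * y) + 1/4 * (c\<^sup>2 * x\<^sup>2)
      + 13/128 * (c ^ 4 * x) + 9/32 * (c\<^sup>2 * v) + 5/512 * c ^ 6"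
    by (simp add: power2_eq_square eval_nat_numeral field_simps)
  \<comment> \<open>The collected coefficients are 133/128 for \<open>c * x\<close>, 9/32 for
    \<open>c * v\<close> and 93/512 for \<open>c^2\<close>, rounded up to 21/20, 3/10 and
    1/5.\<close>
  also have "\<dots> \<le> y\<^sup>2 + 9/8 * (x * v) + 21/20 * (c * x) + 3/10 * (c * v) + 1/5 * c\<^sup>2"
  proof -
    have "0 \<le> c * x" "0 \<le> c * v" "0 \<le> c\<^sup>2"
      using nonneg by simp_all
    with 1 2 3 4 5 6 show ?thesis by linarith
  qed
  also have "\<dots> \<le> c\<^sup>2 + x\<^sup>2 + y\<^sup>2 + v\<^sup>2"
  proof -
    \<comment> \<open>The weight 9/16 absorbs the \<open>x * v\<close> term; the 7/16 left of
      \<open>x^2\<close> and of \<open>v^2\<close> completes squares with \<open>c * x\<close> and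
      \<open>c * v\<close>. The total coefficient of \<open>c^2\<close> is about 0.78, below the
      available 4/5.\<close>
    have "0 \<le> 9/16 * (x - v)\<^sup>2 + 7/16 * (x - 6/5 * c)\<^sup>2 + 7/16 * (v - 12/35 * c)\<^sup>2 + 1/10 * c\<^sup>2"
      by simp
    also have "\<dots> \<le> c\<^sup>2 + x\<^sup>2 + v\<^sup>2 - (9/8 * (x * v) + 21/20 * (c * x) + 3/10 * (c * v) + 1/5 * c\<^sup>2)"
      by (simp add: power2_eq_square field_simps)
    finally show ?thesis by linarith
  qed
  also note le
  finally show ?thesis .
qed

lemma norm_hankel2_3_le:
  assumes "f \<in> class_SL"
  shows "norm (hankel2 f 3) \<le> 1 / 36"
proof -
  define p where "p = star_quotient f"
  have f: "f \<in> class_A" and p: "p holomorphic_on \<Delta>"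
    using assms by (auto simp: class_SL_def subordinate_def p_def)
  from assms obtain \<omega> where \<omega>: "\<omega> holomorphic_on \<Delta>" "\<omega> 0 = 0" "\<And>z. z \<in> \<Delta> \<Longrightarrow> norm (\<omega> z) < 1"
      and sub: "\<And>z. z \<in> \<Delta> \<Longrightarrow> p z = csqrt (1 + \<omega> z)"
    unfolding class_SL_def subordinate_def p_def by blast
  have f0: "f 0 = 0"
    using f by (simp add: class_A_iff taylor_coeff_zero_one)
  have deriv: "z * deriv f z = p z * f z" if z: "z \<in> \<Delta>" for z
  proof (cases "z = 0")
    case False
    \<comment> \<open>A zero of \<open>f\<close> at \<open>z \<noteq> 0\<close> would give
      \<open>p z = 0\<close> by division by zero, but a root of \<open>1 + \<omega> z\<close> cannot
      vanish; so the quotient may be cleared.\<close>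
    have "1 + \<omega> z \<noteq> 0"
      using \<omega>(3)[OF z] by (auto simp: add_eq_0_iff)
    hence "p z \<noteq> 0"
      using sub[OF z] by simp
    with False show ?thesis
      by (auto simp: p_def star_quotient_def split: if_splits)
  qed (simp add: f0)
  define w where "w = taylor_coeff \<omega>"
  have H: "36 * hankel2 f 3 =
    36 * (w 2 / 4 + (w 1)\<^sup>2 / 16) *
      (w 4 / 8 + w 1 * w 3 / 48 + (w 1)\<^sup>2 * w 2 / 48 - w 1 ^ 4 / 384)
    - (w 3 + w 1 * w 2 / 4 + w 1 ^ 3 / 16)\<^sup>2"
    unfolding w_def using sub deriv
    by (intro hankel2_3_schwarz_coeffs[OF f \<omega>(1) p]) (auto simp: p_def star_quotient_def)
  have "(\<Sum>k\<le>4. (norm (w k))\<^sup>2) \<le> 1"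
    unfolding w_def using \<omega> by (intro taylor_coeff_bessel) (auto intro: less_imp_le)
  hence bessel: "(norm (w 1))\<^sup>2 + (norm (w 2))\<^sup>2 + (norm (w 3))\<^sup>2 + (norm (w 4))\<^sup>2 \<le> 1"
    using \<omega>(2) by (simp add: numeral_eq_Suc w_def taylor_coeff_zero_one)
  have 1: "norm (w 2 / 4 + (w 1)\<^sup>2 / 16) \<le> norm (w 2) / 4 + (norm (w 1))\<^sup>2 / 16"
    by (rule norm_triangle_le) (simp add: norm_divide norm_power)
  have 2: "norm (w 4 / 8 + w 1 * w 3 / 48 + (w 1)\<^sup>2 * w 2 / 48 - w 1 ^ 4 / 384)
      \<le> norm (w 4) / 8 + norm (w 1) * norm (w 3) / 48 + (norm (w 1))\<^sup>2 * norm (w 2) / 48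
        + norm (w 1) ^ 4 / 384"
    by (rule order_trans[OF norm_triangle_ineq4] add_mono norm_triangle_le |
        simp add: norm_divide norm_power norm_mult)+
  have 3: "norm (w 3 + w 1 * w 2 / 4 + w 1 ^ 3 / 16)
      \<le> norm (w 3) + norm (w 1) * norm (w 2) / 4 + norm (w 1) ^ 3 / 16"
    by (rule add_mono norm_triangle_le | simp add: norm_divide norm_power norm_mult)+
  have "36 * norm (hankel2 f 3) = norm (36 * hankel2 f 3)"
    by (simp add: norm_mult)
  also have "\<dots> \<le> 36 * norm (w 2 / 4 + (w 1)\<^sup>2 / 16) *
      norm (w 4 / 8 + w 1 * w 3 / 48 + (w 1)\<^sup>2 * w 2 / 48 - w 1 ^ 4 / 384)
    + (norm (w 3 + w 1 * w 2 / 4 + w 1 ^ 3 / 16))\<^sup>2"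
    unfolding H by (rule order_trans[OF norm_triangle_ineq4]) (simp only: norm_mult norm_power norm_numeral)
  also have "\<dots> \<le> 36 * (norm (w 2) / 4 + (norm (w 1))\<^sup>2 / 16) *
      (norm (w 4) / 8 + norm (w 1) * norm (w 3) / 48 + (norm (w 1))\<^sup>2 * norm (w 2) / 48
        + norm (w 1) ^ 4 / 384)
    + (norm (w 3) + norm (w 1) * norm (w 2) / 4 + norm (w 1) ^ 3 / 16)\<^sup>2"
    using 1 2 3 by (intro add_mono mult_mono power_mono mult_nonneg_nonneg add_nonneg_nonneg) auto
  also have "\<dots> \<le> 1"
    by (rule hankel_majorant_le_one) (use bessel in auto)
  finally show ?thesis by simp
qed

section \<open>Sharpness\<close>

text \<open>For \<open>\<omega> z = z ^ 3\<close>, solve \<open>z f' = p f\<close> with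
  \<open>p = csqrt (1 + z ^ 3)\<close>: the logarithmic derivative is
  \<open>1/z + (p - 1)/z\<close>, so \<open>f\<close> is \<open>z\<close> times the exponential of a
  primitive of the second summand.\<close>

lemma extremal_function:
  "\<exists>f\<in>class_SL. norm (hankel2 f 3) = 1 / 36"
proof -
  define p :: "complex \<Rightarrow> complex" where "p = (\<lambda>z. csqrt (1 + z ^ 3))"
  have cube: "norm (z ^ 3) < 1" if "z \<in> \<Delta>" for z :: complex
    using that by (simp add: norm_power power_less_one_iff)
  have p: "p holomorphic_on \<Delta>"
    unfolding p_def
    using cube by (intro holomorphic_on_compose_gen[OF _ csqrt_one_plus_holomorphic, unfolded o_def]
        holomorphic_intros) auto
  have p1: "p z + 1 \<noteq> 0" for z
  proof
    assume "p z + 1 = 0"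
    hence "p z = - 1"
      by (simp add: eq_neg_iff_add_eq_0)
    moreover have "0 \<le> Re (p z)"
      unfolding p_def by (rule Re_csqrt)
    ultimately show False by simp
  qed
  \<comment> \<open>\<open>(p z - 1) / z\<close> with its singularity at \<open>0\<close> removed\<close>
  define g where "g = (\<lambda>z. z\<^sup>2 / (p z + 1))"
  have g: "g holomorphic_on \<Delta>"
    unfolding g_def by (intro holomorphic_intros p p1)
  \<comment> \<open>Rationalising, \<open>(p - 1) * (p + 1) = z ^ 3\<close>, so \<open>g\<close>
    agrees with \<open>(p - 1)/z\<close> away from 0.\<close>
  have zg: "1 + z * g z = p z" for z
  proof -
    have "(p z)\<^sup>2 = 1 + z ^ 3"
      by (simp add: p_def)
    hence "z * z\<^sup>2 = (p z - 1) * (p z + 1)"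
      by (simp add: power2_eq_square power3_eq_cube algebra_simps)
    thus ?thesis
      using p1[of z] by (simp add: g_def divide_simps algebra_simps)
  qed
  obtain G where G: "\<And>z. z \<in> \<Delta> \<Longrightarrow> (G has_field_derivative g z) (at z within \<Delta>)"
    using holomorphic_convex_primitive'[OF convex_ball open_ball g] by blast
  define f where "f = (\<lambda>z. z * exp (G z - G 0))"
  have f': "(f has_field_derivative p z * exp (G z - G 0)) (at z)" if "z \<in> \<Delta>" for z
  proof -
    have "(G has_field_derivative g z) (at z)"
      using G[OF that] that by (simp add: at_within_open[OF _ open_ball])
    hence "(f has_field_derivative (1 + z * g z) * exp (G z - G 0)) (at z)"
      unfolding f_def by (auto intro!: derivative_eq_intros simp: algebra_simps)
    thus ?thesis by (simp only: zg)
  qed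
  have "f holomorphic_on \<Delta>"
    using f' by (subst holomorphic_on_open) blast+
  moreover have "p 0 = 1"
    by (simp add: p_def)
  ultimately have A: "f \<in> class_A"
    using DERIV_imp_deriv[OF f'[of 0]] by (simp add: class_A_iff taylor_coeff_zero_one f_def del: One_nat_def)
  have deriv: "deriv f z = p z * exp (G z - G 0)" if "z \<in> \<Delta>" for z
    using f'[OF that] by (rule DERIV_imp_deriv)
  have sq: "star_quotient f z = p z" if "z \<in> \<Delta>" for z
    using \<open>p 0 = 1\<close> by (simp add: star_quotient_def deriv[OF that]) (simp add: f_def)
  have cubeholo: "(\<lambda>z::complex. z ^ 3) holomorphic_on \<Delta>"
    by (intro holomorphic_intros)
  have "star_quotient f holomorphic_on \<Delta>"
    using p sq by (metis holomorphic_cong)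
  hence "star_quotient f \<prec> (\<lambda>z. csqrt (1 + z))"
    unfolding subordinate_def using csqrt_one_plus_holomorphic cubeholo cube sq
    by (intro conjI exI[of _ "\<lambda>z. z ^ 3"]) (auto simp: p_def)
  with A have "f \<in> class_SL"
    by (simp add: class_SL_def)
  moreover have coeff: "taylor_coeff (\<lambda>z. z ^ 3) n = (if n = 3 then 1 else 0)" for n
    by (subst taylor_coeff_eqI[OF has_fps_expansion_fps_X_power]) simp
  \<comment> \<open>Only \<open>w 3 = 1\<close> is nonzero, so the formula collapses to
    \<open>- (w 3)^2\<close>.\<close>
  have "36 * hankel2 f 3 = - 1"
    using \<open>p 0 = 1\<close> deriv
    by (subst hankel2_3_schwarz_coeffs[OF A cubeholo p]) (auto simp: coeff p_def f_def)
  hence "36 * norm (hankel2 f 3) = 1"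
    by (metis norm_minus_cancel norm_mult norm_numeral norm_one)
  hence "norm (hankel2 f 3) = 1 / 36"
    by simp
  ultimately show ?thesis by blast
qed

theorem theorem2p2:
  "(\<forall>f\<in>class_SL. norm (hankel2 f 3) \<le> 1 / 36) \<and>
   (\<exists>f\<in>class_SL. norm (hankel2 f 3) = 1 / 36)"
  using norm_hankel2_3_le extremal_function by blast

end
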